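(* Let $n\ge 3$ and $1\le l\le n-2$ be integers. Set $X=\{2^n-2^j : 0\le j\le n\}$, $m=(2^{n+1}-1)+(2^n-2^l)$, $Y=m-X=\{m-x : x\in X\}$, $B=X\sqcup Y$, $a=2^n$, and $A=B\sqcup\{a\}$. Then $A$ is a normalised set with $|A+A|=|A-A|+1$ (in particular $|A+A|>|A-A|$).
   Context: For $A\subseteq\mathbb{Z}$, $A+A=\{a_1+a_2 : a_1,a_2\in A\}$ and $A-A=\{a_1-a_2 : a_1,a_2\in A\}$. A finite set $A\subseteq\mathbb{Z}$ is normalised if its smallest element is $0$ and the greatest common divisor of its elements is $1$. *)

theory Defs
  imports Main "HOL-Library.Set_Algebras"
begin

text \<open>
  The sumset of \<open>A\<close> and \<open>B\<close> is the elementwise sum \<open>A + B\<close> of the library. On sets, however,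
  \<open>A - B\<close> is the relative complement, so the difference set needs a constant of its own.
\<close>

definition diffset :: "int set \<Rightarrow> int set \<Rightarrow> int set" where
  "diffset A B = {a - b | a b. a \<in> A \<and> b \<in> B}"

definition normalised :: "int set \<Rightarrow> bool" where
  "normalised A \<longleftrightarrow> finite A \<and> A \<noteq> {} \<and> Min A = 0 \<and> Gcd A = 1"

end

theory Submission
  imports Defs
begin

text \<open>
  The set \<open>B\<close> is symmetric about \<open>m / 2\<close>, so \<open>B - B = (B + B) - m\<close>. Moreover \<open>a + B \<subseteq> B + B\<close>.
  With \<open>N = 2 ^ n\<close> and \<open>L = 2 ^ l\<close>, the identities
  \<open>N + (N - 2 ^ (j + 1)) = 2 * (N - 2 ^ j)\<close> and
  \<open>N + (2 * N - 1 - L + 2 ^ j) = (N - 2 ^ j) + (2 * N - 1 - L + 2 ^ (j + 1))\<close>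
  cover every element but \<open>N - 1\<close> and \<open>3 * N - 1 - L\<close>, and for these
  \<open>N + (N - 1) = 0 + (2 * N - 1)\<close> and \<open>N + (3 * N - 1 - L) = (2 * N - 1) + (2 * N - L)\<close>, where
  \<open>2 * N - 1 \<in> Y\<close> thanks to the term \<open>2 ^ l\<close> in \<open>m\<close>. Hence adjoining \<open>a\<close> leaves the difference set
  unchanged, while the sumset gains exactly \<open>2 * a\<close>, which is kept out of \<open>B + B\<close> by size and
  parity.
\<close>

lemma card_sumset_insert_symmetric:
  fixes a m :: int and B :: "int set"
  assumes "finite B" "B \<noteq> {}"
    and sym: "\<And>b. b \<in> B \<Longrightarrow> m - b \<in> B"
    and translate: "\<And>b. b \<in> B \<Longrightarrow> a + b \<in> B + B"
    and double: "2 * a \<notin> B + B"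
  shows "card (insert a B + insert a B) = card (diffset (insert a B) (insert a B)) + 1"
proof -
  let ?A = "insert a B"
  have sum: "?A + ?A = insert (2 * a) (B + B)"
  proof
    show "?A + ?A \<subseteq> insert (2 * a) (B + B)"
    proof
      fix z assume "z \<in> ?A + ?A"
      then obtain x y where "z = x + y" "x \<in> ?A" "y \<in> ?A"
        by (rule set_plus_elim)
      then consider "z = 2 * a" | b where "b \<in> B" "z = a + b" | "x \<in> B" "y \<in> B" "z = x + y"
        by fastforce
      then show "z \<in> insert (2 * a) (B + B)"
        by cases (simp_all add: translate set_plus_intro)
    qed
    show "insert (2 * a) (B + B) \<subseteq> ?A + ?A"
      using set_plus_intro[of a ?A a ?A] set_plus_mono2[of B ?A B ?A] by auto
  qed
  \<comment> \<open>Since \<open>x - y = (x + (m - y)) - m\<close>, every difference is tested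
    through \<open>x + (m - y)\<close>, a sum whenever \<open>y\<close> can be reflected inside
    \<open>B\<close>.\<close>
  have shift: "x - y \<in> (\<lambda>z. z - m) ` (B + B)" if "x + (m - y) \<in> B + B" for x y
    using that by (auto intro: image_eqI[where x = "x + (m - y)"])
  have diff: "diffset ?A ?A = (\<lambda>z. z - m) ` (B + B)"
  proof
    show "diffset ?A ?A \<subseteq> (\<lambda>z. z - m) ` (B + B)"
    proof
      fix z assume "z \<in> diffset ?A ?A"
      then obtain x y where z: "z = x - y" and x: "x \<in> ?A" and y: "y \<in> ?A"
        by (auto simp: diffset_def)
      consider "y \<in> B" | "x \<in> B" "y = a" | "x = a" "y = a"
        using x y by auto
      then have "x + (m - y) \<in> B + B"
      proof cases
        case 1
        then show ?thesis
          using x sym translate by (auto intro: set_plus_intro)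
      next
        \<comment> \<open>The element \<open>m - a\<close> need not lie in \<open>B\<close>, so
          \<open>a + (m - x)\<close> is split as \<open>b + c\<close> instead. Reflecting both
          summands gives \<open>2 * m - (a + m - x) = x + (m - a)\<close>.\<close>
        case 2
        then obtain b c where bc: "b \<in> B" "c \<in> B" "a + (m - x) = b + c"
          using translate[OF sym] by (meson set_plus_elim)
        then have "x + (m - y) = (m - b) + (m - c)"
          using 2 by simp
        then show ?thesis
          using bc sym by (metis set_plus_intro)
      next
        \<comment> \<open>The difference is 0, which corresponds to \<open>m\<close> itself, the sum
          of any element and its reflection.\<close>
        case 3
        obtain b where "b \<in> B"
          using \<open>B \<noteq> {}\<close> by blast
        then have "b + (m - b) \<in> B + B"
          using sym by (intro set_plus_intro)
        then show ?thesis
          using 3 by simp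
      qed
      then show "z \<in> (\<lambda>z. z - m) ` (B + B)"
        using shift z by blast
    qed
    show "(\<lambda>z. z - m) ` (B + B) \<subseteq> diffset ?A ?A"
    proof
      fix z assume "z \<in> (\<lambda>z. z - m) ` (B + B)"
      then obtain x y where "x \<in> B" "y \<in> B" "z = x + y - m"
        by (auto elim!: set_plus_elim)
      then have "x \<in> ?A" "m - y \<in> ?A" "z = x - (m - y)"
        using sym by auto
      then show "z \<in> diffset ?A ?A"
        unfolding diffset_def by blast
    qed
  qed
  have "card (?A + ?A) = card (B + B) + 1"
    using \<open>finite B\<close> double by (simp add: sum finite_set_plus)
  moreover have "card (diffset ?A ?A) = card (B + B)"
    by (simp add: diff card_image inj_on_def)
  ultimately show ?thesis
    by simp
qed

theorem theorem3:
  fixes n l :: nat and m a :: int and X Y B A :: "int set"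
  assumes "n \<ge> 3" and "1 \<le> l" and "l \<le> n - 2"
    and "X = {2 ^ n - 2 ^ j | j :: nat. 0 \<le> j \<and> j \<le> n}"
    and "m = (2 ^ (n + 1) - 1) + (2 ^ n - 2 ^ l)"
    and "Y = {m - x | x. x \<in> X}"
    and "B = X \<union> Y"
    and "a = 2 ^ n"
    and "A = B \<union> {a}"
  shows "X \<inter> Y = {} \<and> a \<notin> B \<and> normalised A
    \<and> card (A + A) = card (diffset A A) + 1
    \<and> card (A + A) > card (diffset A A)"
proof -
  define N L :: int where "N = 2 ^ n" and "L = 2 ^ l"
  have aN: "a = N" and m: "m = 3 * N - 1 - L"
    using assms by (simp_all add: N_def L_def)
  have X: "X = {N - 2 ^ j | j. j \<le> n}"
    using assms by (simp add: N_def)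
  have Y: "Y = {2 * N - 1 - L + 2 ^ j | j. j \<le> n}"
  proof -
    have "Y = (\<lambda>x. m - x) ` (\<lambda>j. N - 2 ^ j) ` {..n}"
      using assms(6) X by auto
    also have "\<dots> = (\<lambda>j. 2 * N - 1 - L + 2 ^ j) ` {..n}"
      by (simp add: image_image m algebra_simps)
    finally show ?thesis
      by auto
  qed
  have pow: "1 \<le> (2::int) ^ j" "(2::int) ^ j \<le> N" if "j \<le> n" for j
    using that by (simp_all add: N_def)
  have "(2::int) ^ 3 \<le> 2 ^ n"
    using assms(1) by (intro power_increasing) auto
  then have N8: "8 \<le> N"
    by (simp add: N_def)
  \<comment> \<open>This is where \<open>l \<le> n - 2\<close> enters: \<open>L\<close> is at most a
    quarter of \<open>N\<close>, which puts \<open>Y\<close> above \<open>N\<close> and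
    \<open>X\<close> below it.\<close>
  have "(2::int) ^ (l + 2) \<le> 2 ^ n"
    using assms(1,3) by (intro power_increasing) auto
  then have LN: "4 * L \<le> N"
    by (simp add: N_def L_def)
  have L2: "2 \<le> L"
    using power_increasing[of 1 l "2::int"] assms(2) by (simp add: L_def)
  have l: "l \<le> n"
    using assms(3) by simp
  have Xlo: "0 \<le> x" and Xhi: "x \<le> N - 1" if "x \<in> X" for x
    using that pow by (auto simp: X)
  have Ylo: "2 * N - L \<le> y" if "y \<in> Y" for y
    using that pow by (auto simp: Y)
  have memX: "N - 2 ^ j \<in> X" and memY: "2 * N - 1 - L + 2 ^ j \<in> Y" if "j \<le> n" for j
    using that by (auto simp: X Y)
  have zero: "0 \<in> X"
    using memX[of n] by (simp add: N_def)

  have disjoint: "X \<inter> Y = {}"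
    using Xhi Ylo LN N8 by force
  have notin: "a \<notin> B"
    using Xhi[of N] Ylo[of N] LN N8 by (auto simp: aN assms(7))

  have "X = (\<lambda>j. N - 2 ^ j) ` {..n}" "Y = (\<lambda>j. 2 * N - 1 - L + 2 ^ j) ` {..n}"
    by (auto simp: X Y)
  then have finB: "finite B"
    by (simp add: assms(7))
  have A: "A = insert a B"
    by (simp add: assms(9))
  have normalised: "normalised A"
  proof -
    have "Min A = 0"
    proof (rule Min_eqI)
      show "finite A"
        using finB by (simp add: A)
      show "0 \<in> A"
        using zero by (simp add: A assms(7))
      show "0 \<le> x" if "x \<in> A" for x
        using that Xlo[of x] Ylo[of x] LN N8 by (auto simp: A assms(7) aN)
    qed
    moreover have "Gcd A = 1"
    proof -
      \<comment> \<open>The consecutive integers \<open>N = a\<close> and \<open>N - 1\<close>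
        (exponent 0 in \<open>X\<close>) both lie in \<open>A\<close>.\<close>
      have "Gcd A dvd N" "Gcd A dvd N - 1"
        using memX[of 0] by (auto simp only: A aN assms(7) power_0 intro!: Gcd_dvd)
      then have "Gcd A dvd N - (N - 1)"
        by (rule dvd_diff)
      then have "is_unit (Gcd A)"
        by simp
      then show ?thesis
        by simp
    qed
    ultimately show ?thesis
      using finB by (auto simp: normalised_def A)
  qed

  have sym: "m - b \<in> B" if "b \<in> B" for b
    using that assms(6) by (auto simp: assms(7))
  have translate: "a + b \<in> B + B" if b: "b \<in> B" for b
  proof -
    have plus: "z \<in> B + B" if "z = x + y" "x \<in> X \<union> Y" "y \<in> X \<union> Y" for x y z
      using that by (auto simp: assms(7))
    consider j where "j \<le> n" "b = N - 2 ^ j" | j where "j \<le> n" "b = 2 * N - 1 - L + 2 ^ j"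
      using b by (auto simp: assms(7) X Y)
    then show ?thesis
    proof cases
      case (1 j)
      show ?thesis
      proof (cases j)
        case 0
        show ?thesis
          using plus[of "a + b" 0 "2 * N - 1 - L + 2 ^ l"] zero memY[OF l] 0 1
          by (simp add: aN L_def)
      next
        case (Suc k)
        then show ?thesis
          using plus[of "a + b" "N - 2 ^ k" "N - 2 ^ k"] memX[of k] 1
          by (simp add: aN)
      qed
    next
      case (2 j)
      show ?thesis
      proof (cases "j = n")
        \<comment> \<open>The exponent \<open>Suc j\<close> would exceed \<open>n\<close> here.
          Instead \<open>2 ^ l\<close> cancels \<open>L\<close> in the first summand and
          \<open>2 ^ 0\<close> cancels the \<open>-1\<close> in the second.\<close>
        case True
        then show ?thesis
          using plus[of "a + b" "2 * N - 1 - L + 2 ^ l" "2 * N - 1 - L + 2 ^ 0"]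
            memY[OF l] memY[of 0] 2
          by (simp add: aN L_def N_def)
      next
        case False
        then show ?thesis
          using plus[of "a + b" "N - 2 ^ j" "2 * N - 1 - L + 2 ^ Suc j"]
            memX[of j] memY[of "Suc j"] 2
          by (simp add: aN)
      qed
    qed
  qed
  have mixed: "x + y \<noteq> 2 * N" if "x \<in> X" "y \<in> Y" for x y
  proof
    assume "x + y = 2 * N"
    moreover obtain i k where ik: "i \<le> n" "k \<le> n" "x = N - 2 ^ i" "y = 2 * N - 1 - L + 2 ^ k"
      using \<open>x \<in> X\<close> \<open>y \<in> Y\<close> by (auto simp: X Y)
    ultimately have eq: "N - L + 2 ^ k = 2 ^ i + 1"
      by simp
    have "even N" "even L"
      using assms(1,2) by (auto simp: N_def L_def)
    \<comment> \<open>As \<open>N - L\<close> is even, \<open>2 ^ k\<close> and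
      \<open>2 ^ i + 1\<close> have the same parity, so exactly one of \<open>i\<close> and
      \<open>k\<close> is 0.\<close>
    then have "even ((2::int) ^ k) \<noteq> even ((2::int) ^ i)"
      using arg_cong[OF eq, of even] by simp
    then consider "k = 0" "0 < i" | "i = 0"
      by auto
    then show False
    proof cases
      case 1
      then have eq': "N - L = 2 ^ i"
        using eq by simp
      with L2 have "(2::int) ^ i < 2 ^ n"
        \<comment> \<open>A power of two strictly below \<open>N\<close> is at most
          \<open>N / 2\<close>; then \<open>N - L = 2 ^ i\<close> would force
          \<open>L \<ge> N / 2\<close>, against \<open>4 * L \<le> N\<close>.\<close>
        unfolding N_def by linarith
      then have "(2::int) ^ Suc i \<le> 2 ^ n"
        by (intro power_increasing) auto
      then show False
        using eq' LN N8 by (simp add: N_def)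
    next
      \<comment> \<open>Now \<open>N - L + 2 ^ k = 2\<close>, although \<open>N - L\<close> is
        already at least 6.\<close>
      case 2
      then show False
        using eq pow(1)[OF ik(2)] LN N8 by simp
    qed
  qed
  have double: "2 * a \<notin> B + B"
  proof
    assume "2 * a \<in> B + B"
    then obtain x y where xy: "2 * N = x + y" "x \<in> X \<union> Y" "y \<in> X \<union> Y"
      by (auto simp: aN assms(7) elim!: set_plus_elim)
    then consider "x \<in> X" "y \<in> X" | "x \<in> X" "y \<in> Y" | "y \<in> X" "x \<in> Y" | "x \<in> Y" "y \<in> Y"
      by blast
    \<comment> \<open>Size settles the unmixed sums: two elements of \<open>X\<close> give at most
      \<open>2 * N - 2\<close>, two of \<open>Y\<close> at least
      \<open>4 * N - 2 * L > 2 * N\<close>.\<close>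
    then show False
      using xy(1) Xhi[of x] Xhi[of y] Ylo[of x] Ylo[of y] mixed[of x y] mixed[of y x] LN N8
      by cases auto
  qed
  have "card (A + A) = card (diffset A A) + 1"
    unfolding A using finB zero assms(7) sym translate double
    by (intro card_sumset_insert_symmetric) auto
  then show ?thesis
    using disjoint notin normalised by simp
qed

end
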